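(* Let $\mu$ be a probability measure on $\mathbb{R}$, absolutely continuous with density $f$, whose support is not included in $(-\infty,0)$. Assume there is $a\ge0$ and a positive Borel measure $\nu$ on $(0,\infty)$ such that $f(t)=\int_0^\infty e^{-ut}\,\nu(du)$ for all $t>a$ (i.e. $f$ is completely monotone on $(a,\infty)$), and that the support of $\nu$ contains an increasing sequence $(a_n)$ with $\sum_n a_n^{-1}=+\infty$. Then: (i) for any two nonnegative Borel functions $g_1,g_2$ on $[0,\infty)$ such that $\int_0^\infty f(t+s)g_1(s)\,ds<\infty$ and $\int_0^\infty f(t+s)g_2(s)\,ds<\infty$ for all $t\ge0$, if $\int_0^\infty f(t+s)g_1(s)\,ds=\int_0^\infty f(t+s)g_2(s)\,ds$ for all $t\ge 0$ then $g_1=g_2$ almost everywhere; (ii) $\mu$ is characterized by the restrictions of $\mu$ and $\mu*\mu$ to $[0,\infty)$, i.e. any probability measure $\mu_1$ on $\mathbb{R}$ with $\mu_1=\mu$ and $\mu_1*\mu_1=\mu*\mu$ on the Borel subsets of $[0,\infty)$ equals $\mu$; (iii) in particular $\mu\in\mathscr{C}$.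
   Context: $\mathscr{C}$ is the set of probability measures $\mu$ on $\mathbb{R}$ such that every probability measure $\mu_1$ with $\mu_1^{*n}=\mu^{*n}$ on $[0,\infty)$ for all $n\ge1$ ($*n$ = $n$-fold convolution power) equals $\mu$. *)

theory Defs
  imports "HOL-Probability.Probability" "HOL-Probability.Convolution"
begin

definition measure_support :: "real measure \<Rightarrow> real set" where
  "measure_support M = {x. \<forall>U. open U \<longrightarrow> x \<in> U \<longrightarrow> emeasure M U > 0}"

primrec conv_pow :: "real measure \<Rightarrow> nat \<Rightarrow> real measure" where
  "conv_pow M 0 = return borel 0"
| "conv_pow M (Suc n) = (M \<star> conv_pow M n)"

definition real_prob :: "real measure \<Rightarrow> bool" where
  "real_prob M \<longleftrightarrow> prob_space M \<and> sets M = sets borel"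

definition class_C :: "real measure set" where
  "class_C = {\<mu>. real_prob \<mu> \<and>
     (\<forall>\<mu>1. real_prob \<mu>1 \<longrightarrow>
        (\<forall>n\<ge>1. \<forall>A\<in>sets borel. A \<subseteq> {0..} \<longrightarrow>
            emeasure (conv_pow \<mu>1 n) A = emeasure (conv_pow \<mu> n) A)
        \<longrightarrow> \<mu>1 = \<mu>)}"

end

theory Submission
  imports Defs
begin

text \<open>
  For a measure \<open>M\<close> on \<open>[0,\<infinity>)\<close> with Laplace transform \<open>L\<close>, Tonelli's theorem turns
  \<open>\<integral> f(t + s) M(ds)\<close>, \<open>t > a\<close>, into the Laplace transform of \<open>L(u) \<nu>(du)\<close>. Hence two measures with
  the same integrals have transforms \<open>L\<^sub>1 = L\<^sub>2\<close> \<open>\<nu>\<close>-almost everywhere, in particular at points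
  \<open>u\<^sub>n\<close> chosen near the \<open>a\<^sub>n\<close>, and by a theorem of Muntz type this forces the measures to be equal.
  The Muntz theorem is proved by von Golitschek's method: repeatedly applying
  \<open>Q \<mapsto> (\<lambda>\<^sub>n - q) e\<^bsup>-\<lambda>\<^sub>n s\<^esup> \<integral>\<^sub>0\<^sup>s Q(r) e\<^bsup>\<lambda>\<^sub>n r\<^esup> dr\<close> to \<open>e\<^bsup>-q s\<^esup>\<close> only adds multiples of the
  \<open>e\<^bsup>-\<lambda>\<^sub>i s\<^esup>\<close> and multiplies the supremum norm by at most \<open>\<bar>1 - q/\<lambda>\<^sub>n\<bar>\<close>.

  For the second claim, split \<open>\<mu>\<close> into its parts \<open>P\<close> on \<open>[0,\<infinity>)\<close> and \<open>N\<close> on \<open>(-\<infinity>,0)\<close>. On \<open>[0,\<infinity>)\<close> one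
  has \<open>\<mu> * \<mu> = P * P + 2 P * N\<close>, and \<open>P * N\<close> has density \<open>\<integral> f(t - x) N(dx)\<close> there, which
  determines \<open>N\<close> by the above.
\<close>

section \<open>Muntz-type approximation by exponentials\<close>

text \<open>If \<open>Q\<close> is bounded by \<open>B\<close> on the half-line and
  \<open>l = lam n\<close>, then \<open>(l - q) * exp (- l * s)\<close> times the integral of
  \<open>exp (l * r) * Q r\<close> over \<open>[0, s]\<close> is bounded by
  \<open>\<bar>1 - q / l\<bar> * B\<close>, because \<open>l * exp (l * r)\<close> integrates to
  \<open>exp (l * s) - 1\<close>. This operation sends \<open>exp (- q * s)\<close> to
  \<open>exp (- q * s) - exp (- l * s)\<close>, so the leading coefficient stays 1 in the
  induction.\<close>

lemma exp_approx_by_exponentials: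
  fixes lam :: "nat \<Rightarrow> real" and q :: real
  assumes inj: "inj lam" and pos: "\<And>n. 0 < lam n" and ne: "\<And>n. lam n \<noteq> q" and q: "0 \<le> q"
  shows "\<exists>c. \<forall>s\<ge>0. \<bar>exp (- q * s) + (\<Sum>i<n. c i * exp (- lam i * s))\<bar> \<le> (\<Prod>i<n. \<bar>1 - q / lam i\<bar>)"
proof (induction n)
  case 0
  then show ?case using q by auto
next
  case (Suc n)
  then obtain c where c: "\<And>s. s \<ge> 0 \<Longrightarrow>
    \<bar>exp (- q * s) + (\<Sum>i<n. c i * exp (- lam i * s))\<bar> \<le> (\<Prod>i<n. \<bar>1 - q / lam i\<bar>)"
    by blast
  define l where "l = lam n"
  define B where "B = (\<Prod>i<n. \<bar>1 - q / lam i\<bar>)"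
  define C where "C = \<bar>1 - q / l\<bar> * B"
  \<comment> \<open>Integrating \<open>c i * exp ((l - lam i) * r)\<close> over
    \<open>[0, s]\<close> and multiplying by \<open>l - q\<close> gives
    \<open>d i * (exp ((l - lam i) * s) - 1)\<close>; injectivity of \<open>lam\<close> keeps the
    denominator nonzero for \<open>i < n\<close>.\<close>
  define d where "d i = c i * (l - q) / (l - lam i)" for i
  define Q where "Q s = exp (- q * s) + (\<Sum>i<n. c i * exp (- lam i * s))" for s
  define W where "W s = (exp ((l - q) * s) - 1) + (\<Sum>i<n. d i * (exp ((l - lam i) * s) - 1))" for s
  \<comment> \<open>The last coefficient collects all the terms \<open>- 1\<close> in
    \<open>W\<close>, each of which becomes \<open>- exp (- l * s)\<close> after multiplication by
    \<open>exp (- l * s)\<close>.\<close>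
  define c' where "c' i = (if i < n then d i else - 1 - (\<Sum>i<n. d i))" for i
  have l: "l > 0" using pos by (simp add: l_def)
  \<comment> \<open>\<open>W s / exp (l * s)\<close> is the new approximant, and \<open>W s = (l - q) * (\<integral>r=0..s. exp (l * r) * Q r)\<close>.\<close>
  have dl: "d i * (l - lam i) = (l - q) * c i" if "i < n" for i
    using that injD[OF inj, of n i] by (auto simp: d_def l_def)
  have W': "(W has_real_derivative (l - q) * exp (l * s) * Q s) (at s)" for s
  proof -
    have "(W has_real_derivative ((l - q) * exp ((l - q) * s) +
            (\<Sum>i<n. d i * ((l - lam i) * exp ((l - lam i) * s))))) (at s)"
      unfolding W_def by (auto intro!: derivative_eq_intros sum.cong)
    also have "(\<Sum>i<n. d i * ((l - lam i) * exp ((l - lam i) * s))) =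
        (\<Sum>i<n. (l - q) * exp (l * s) * (c i * exp (- lam i * s)))"
    proof (intro sum.cong refl)
      fix i assume "i \<in> {..<n}"
      then have "d i * (l - lam i) = (l - q) * c i" by (intro dl) simp
      moreover have "exp ((l - lam i) * s) = exp (l * s) * exp (- lam i * s)"
        by (simp add: exp_add[symmetric] algebra_simps)
      ultimately show "d i * ((l - lam i) * exp ((l - lam i) * s)) =
        (l - q) * exp (l * s) * (c i * exp (- lam i * s))" by (metis mult.assoc mult.commute)
    qed
    also have "exp ((l - q) * s) = exp (l * s) * exp (- q * s)"
      by (simp add: exp_add[symmetric] algebra_simps)
    finally show ?thesis
      by (simp add: Q_def sum_distrib_left algebra_simps)
  qed
  have W'_le: "\<bar>(l - q) * exp (l * s) * Q s\<bar> \<le> C * (l * exp (l * s))" if "s \<ge> 0" for s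
  proof -
    have "\<bar>(l - q) * exp (l * s) * Q s\<bar> = \<bar>l - q\<bar> * exp (l * s) * \<bar>Q s\<bar>"
      by (simp add: abs_mult)
    also have "\<dots> \<le> \<bar>l - q\<bar> * exp (l * s) * B"
      using c[OF that] by (intro mult_left_mono) (auto simp: Q_def B_def)
    also have "\<bar>l - q\<bar> = \<bar>1 - q / l\<bar> * l"
      using l by (simp add: abs_if field_simps)
    finally show ?thesis by (simp add: C_def mult_ac)
  qed
  \<comment> \<open>The integral bound is obtained without integrals:
    \<open>C * exp (l * s) - \<sigma> * W s\<close> has a nonnegative derivative. The signs
    \<open>\<sigma> = 1\<close> and \<open>\<sigma> = -1\<close> together bound
    \<open>\<bar>W s\<bar>\<close>.\<close>
  have W_le: "\<sigma> * W s \<le> C * (exp (l * s) - 1)" if s: "s \<ge> 0" and \<sigma>: "\<bar>\<sigma>\<bar> = 1" for s \<sigma>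
  proof -
    define V where "V s = C * exp (l * s) - \<sigma> * W s" for s
    have "V 0 \<le> V s"
    proof (rule DERIV_nonneg_imp_nondecreasing[OF s])
      fix r assume r: "0 \<le> r" "r \<le> s"
      have "(V has_real_derivative (C * (l * exp (l * r)) - \<sigma> * ((l - q) * exp (l * r) * Q r))) (at r)"
        unfolding V_def by (auto intro!: derivative_eq_intros W')
      moreover have "\<sigma> * ((l - q) * exp (l * r) * Q r) \<le> C * (l * exp (l * r))"
        using W'_le[OF r(1)] \<sigma> by (metis abs_ge_self abs_mult mult_1 order_trans)
      ultimately show "\<exists>y. (V has_real_derivative y) (at r) \<and> 0 \<le> y" by (intro exI conjI) auto
    qed
    then show ?thesis by (simp add: V_def W_def algebra_simps)
  qed
  have B0: "B \<ge> 0" unfolding B_def by (intro prod_nonneg) auto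
  have "\<bar>exp (- q * s) + (\<Sum>i<Suc n. c' i * exp (- lam i * s))\<bar> \<le> C" if s: "s \<ge> 0" for s
  proof -
    have e: "exp (- l * s) * exp ((l - x) * s) = exp (- x * s)" for x
      by (simp add: exp_add[symmetric] algebra_simps)
    have "exp (- q * s) + (\<Sum>i<Suc n. c' i * exp (- lam i * s)) = exp (- l * s) * W s"
    proof -
      have "exp (- l * s) * W s = (exp (- l * s) * exp ((l - q) * s) - exp (- l * s))
        + (\<Sum>i<n. d i * (exp (- l * s) * exp ((l - lam i) * s) - exp (- l * s)))"
        unfolding W_def by (simp add: sum_distrib_left algebra_simps)
      also have "\<dots> = (exp (- q * s) - exp (- l * s))
        + (\<Sum>i<n. d i * (exp (- lam i * s) - exp (- l * s)))"
        by (simp only: e)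
      also have "\<dots> = exp (- q * s) + (\<Sum>i<Suc n. c' i * exp (- lam i * s))"
        by (simp add: c'_def l_def[symmetric] algebra_simps sum_subtractf sum_distrib_left sum_distrib_right)
      finally show ?thesis by simp
    qed
    also have "\<bar>\<dots>\<bar> = exp (- l * s) * \<bar>W s\<bar>" by (simp add: abs_mult)
    also have "\<dots> \<le> exp (- l * s) * (C * (exp (l * s) - 1))"
      using W_le[OF s, of 1] W_le[OF s, of "-1"] by (intro mult_left_mono) auto
    also have "\<dots> = C * (1 - exp (- l * s))"
      by (simp add: algebra_simps exp_minus)
    also have "\<dots> \<le> C" using B0 by (simp add: C_def mult_left_le)
    finally show ?thesis .
  qed
  then show ?case
    by (intro exI[of _ c']) (simp add: C_def B_def l_def mult.commute)
qed

text \<open>Both branches of the absolute value lie below the line \<open>1 - x / 3\<close>; the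
  branch \<open>x - 1\<close> meets it exactly at \<open>x = 3 / 2\<close>. This bound is what lets
  a divergent sum force a product of factors \<open>\<bar>1 - q / lam i\<bar>\<close> to 0.\<close>

lemma abs_one_minus_le_exp:
  fixes x :: real
  assumes "0 \<le> x" "x \<le> 3 / 2"
  shows "\<bar>1 - x\<bar> \<le> exp (- (x / 3))"
  using exp_ge_add_one_self[of "- (x / 3)"] assms by linarith

section \<open>Laplace transforms of finite measures on the half-line\<close>

lemma (in finite_borel_measure) integrable_exp_neg:
  assumes "AE s in M. 0 \<le> s" "0 \<le> q"
  shows "integrable M (\<lambda>s. exp (- q * s))"
proof (rule integrable_const_bound[of _ 1])
  show "AE s in M. norm (exp (- q * s)) \<le> 1" using assms(1)
    by eventually_elim (use assms(2) in auto)
  show "(\<lambda>s. exp (- q * s)) \<in> borel_measurable M"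
    unfolding measurable_cong_sets[OF M_is_borel refl] by measurable
qed

text \<open>The two measures to be compared live on the whole line and are concentrated on the
  half-line, so that distribution functions remain available.\<close>

locale finite_borel_measure_pair =
  M1: finite_borel_measure M1 + M2: finite_borel_measure M2 for M1 M2 +
  assumes nonneg1: "AE s in M1. 0 \<le> s" and nonneg2: "AE s in M2. 0 \<le> s"
begin

text \<open>Integrate the approximant of \<open>exp (- q * s)\<close> against both measures: the
  added exponentials cancel in the difference, since the transforms agree at the nodes. What remains
  is at most the product of the \<open>\<bar>1 - q / lam i\<bar>\<close> times the total mass, and
  the product tends to 0 because \<open>q / lam i \<le> 3 / 2\<close> and the reciprocals
  diverge.\<close>

lemma laplace_eq_interpolate:
  fixes lam :: "nat \<Rightarrow> real"
  assumes inj: "inj lam" and q: "0 < q" and lam_ge: "\<And>n. q \<le> 3 / 2 * lam n"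
    and div: "\<not> summable (\<lambda>n. 1 / lam n)"
    and eq: "\<And>n. (\<integral>s. exp (- lam n * s) \<partial>M1) = (\<integral>s. exp (- lam n * s) \<partial>M2)"
  shows "(\<integral>s. exp (- q * s) \<partial>M1) = (\<integral>s. exp (- q * s) \<partial>M2)"
proof (cases "\<exists>n. lam n = q")
  case True
  then show ?thesis using eq by auto
next
  case False
  have pos: "lam n > 0" for n using lam_ge[of n] q by linarith
  define K where "K = measure M1 (space M1) + measure M2 (space M2)"
  define D where "D = \<bar>(\<integral>s. exp (- q * s) \<partial>M1) - (\<integral>s. exp (- q * s) \<partial>M2)\<bar>"
  have D_le: "D \<le> (\<Prod>i<n. \<bar>1 - q / lam i\<bar>) * K" for n
  proof -
    define B where "B = (\<Prod>i<n. \<bar>1 - q / lam i\<bar>)"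
    obtain c where c: "\<And>s. s \<ge> 0 \<Longrightarrow> \<bar>exp (- q * s) + (\<Sum>i<n. c i * exp (- lam i * s))\<bar> \<le> B"
      using exp_approx_by_exponentials[OF inj pos, of q n] False q unfolding B_def by auto
    define Q where "Q s = exp (- q * s) + (\<Sum>i<n. c i * exp (- lam i * s))" for s
    have *: "integrable M Q \<and> \<bar>integral\<^sup>L M Q\<bar> \<le> B * measure M (space M) \<and>
       integral\<^sup>L M Q = (\<integral>s. exp (- q * s) \<partial>M) + (\<Sum>i<n. c i * (\<integral>s. exp (- lam i * s) \<partial>M))"
      if "finite_borel_measure M" "AE s in M. 0 \<le> s" for M
    proof (intro conjI)
      interpret finite_borel_measure M by fact
      have i: "integrable M (\<lambda>s. exp (- q * s))" "integrable M (\<lambda>s. exp (- lam i * s))" for i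
        using integrable_exp_neg[OF that(2)] q pos[of i] by auto
      show int: "integrable M Q" unfolding Q_def
        by (intro Bochner_Integration.integrable_add Bochner_Integration.integrable_sum integrable_mult_right i)
      show "integral\<^sup>L M Q = (\<integral>s. exp (- q * s) \<partial>M) + (\<Sum>i<n. c i * (\<integral>s. exp (- lam i * s) \<partial>M))"
        unfolding Q_def using i by (simp add: Bochner_Integration.integral_sum)
      have "\<bar>integral\<^sup>L M Q\<bar> \<le> (\<integral>s. \<bar>Q s\<bar> \<partial>M)" by (rule integral_abs_bound)
      also have "\<dots> \<le> (\<integral>s. B \<partial>M)"
      proof (intro integral_mono_AE integrable_abs int)
        show "AE s in M. \<bar>Q s\<bar> \<le> B"
          using that(2) by eventually_elim (auto simp only: Q_def c)
      qed simp
      finally show "\<bar>integral\<^sup>L M Q\<bar> \<le> B * measure M (space M)" by (simp add: mult.commute)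
    qed
    have "D = \<bar>integral\<^sup>L M1 Q - integral\<^sup>L M2 Q\<bar>"
      using *[OF M1.finite_borel_measure_axioms nonneg1] *[OF M2.finite_borel_measure_axioms nonneg2]
      unfolding D_def by (simp only: eq add_diff_cancel_right)
    also have "\<dots> \<le> B * K"
      using *[OF M1.finite_borel_measure_axioms nonneg1] *[OF M2.finite_borel_measure_axioms nonneg2]
      unfolding K_def by (auto simp: algebra_simps)
    finally show ?thesis by (simp add: B_def)
  qed
  have "D = 0"
  proof (rule ccontr)
    assume "D \<noteq> 0"
    then have "D > 0" by (simp add: D_def)
    \<comment> \<open>For \<open>n = 0\<close> the product is empty, so
      \<open>D \<le> K\<close>.\<close>
    have K: "K > 0"
      using D_le[of 0] \<open>D > 0\<close> by auto
    \<comment> \<open>Taking logarithms in the bound for \<open>D / K\<close> gives a bound on the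
      partial sums that does not depend on \<open>n\<close>.\<close>
    have "summable (\<lambda>n. 1 / lam n)"
    proof (rule summableI_nonneg_bounded)
      fix n
      show "0 \<le> 1 / lam n" using pos[of n] by simp
      have "D / K \<le> (\<Prod>i<n. \<bar>1 - q / lam i\<bar>)"
        using D_le[of n] K by (simp add: divide_le_eq)
      also have "\<dots> \<le> (\<Prod>i<n. exp (- (q / lam i / 3)))"
        using pos lam_ge q by (intro prod_mono conjI abs_one_minus_le_exp)
          (auto simp: divide_le_eq less_imp_le)
      also have "\<dots> = exp (- (q / 3 * (\<Sum>i<n. 1 / lam i)))"
        by (simp add: exp_sum[symmetric] sum_negf sum_distrib_left mult.commute)
      finally have "ln (D / K) \<le> - (q / 3 * (\<Sum>i<n. 1 / lam i))"
        using \<open>D > 0\<close> K by (metis divide_pos_pos exp_gt_zero ln_exp ln_le_cancel_iff)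
      then show "(\<Sum>i<n. 1 / lam i) \<le> - (3 / q * ln (D / K))"
        using q by (simp add: field_simps)
    qed
    with div show False by contradiction
  qed
  then show ?thesis by (simp add: D_def)
qed

text \<open>Frees \<open>q\<close> from the bound \<open>3 / 2 * lam n\<close> of the interpolation:
  equality near 0 is propagated to all positive arguments.\<close>

lemma laplace_eq_extend:
  fixes lam :: "nat \<Rightarrow> real"
  assumes mono: "strict_mono lam" and pos: "\<And>n. 0 < lam n"
    and div: "\<not> summable (\<lambda>n. 1 / lam n)"
    and eq: "\<And>n. (\<integral>s. exp (- lam n * s) \<partial>M1) = (\<integral>s. exp (- lam n * s) \<partial>M2)"
    and q: "0 < q"
  shows "(\<integral>s. exp (- q * s) \<partial>M1) = (\<integral>s. exp (- q * s) \<partial>M2)"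
proof -
  \<comment> \<open>If \<open>lam\<close> is bounded, interpolation reaches \<open>q\<close> only in steps: equality on \<open>(0, L]\<close> gives a new
    bounded sequence of nodes in \<open>[5/6 L, L]\<close>, hence equality up to \<open>5/4 L\<close>.\<close>
  have "\<forall>q. 0 < q \<and> q \<le> lam 0 * (5 / 4) ^ k \<longrightarrow>
      (\<integral>s. exp (- q * s) \<partial>M1) = (\<integral>s. exp (- q * s) \<partial>M2)" for k
  proof (induction k)
    case 0
    have "q \<le> 3 / 2 * lam n" if "q \<le> lam 0" "0 < q" for q n
      using that strict_mono_leD[OF mono, of 0 n] by auto
    then show ?case
      using laplace_eq_interpolate[OF strict_mono_imp_inj_on[OF mono] _ _ div eq] by auto
  next
    case (Suc k)
    define L where "L = lam 0 * (5 / 4) ^ k"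
    define lm where "lm n = L * (1 - 1 / (6 * (real n + 1)))" for n
    have L: "L > 0" using pos by (simp add: L_def)
    have lm: "5 / 6 * L \<le> lm n" "lm n \<le> L" for n
    proof -
      have "1 / (6 * (real n + 1)) \<le> 1 / 6" "1 / (6 * (real n + 1)) \<ge> 0" by (auto simp: field_simps)
      then have "L * (5 / 6) \<le> lm n" "lm n \<le> L * 1" using L unfolding lm_def
        by (auto intro!: mult_left_mono)
      then show "5 / 6 * L \<le> lm n" "lm n \<le> L" by auto
    qed
    have inj: "inj lm"
      using L by (auto simp: inj_on_def lm_def)
    have div': "\<not> summable (\<lambda>n. 1 / lm n)"
    proof
      assume "summable (\<lambda>n. 1 / lm n)"
      moreover have "norm (1 / L) \<le> 1 / lm n" for n
        using lm[of n] L by (auto intro!: divide_left_mono mult_pos_pos)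
      ultimately have "summable (\<lambda>n::nat. 1 / L)" by (rule summable_comparison_test'[where N = 0])
      then show False using L by (simp add: summable_const_iff)
    qed
    have eq': "(\<integral>s. exp (- lm n * s) \<partial>M1) = (\<integral>s. exp (- lm n * s) \<partial>M2)" for n
      using Suc lm[of n] L by (auto simp: L_def)
    \<comment> \<open>The growth factor 5/4 is the interpolation bound 3/2 times the lower end 5/6
      of the nodes.\<close>
    have "q \<le> 3 / 2 * lm n" if "q \<le> lam 0 * (5 / 4) ^ Suc k" for q n
    proof -
      have "q \<le> 5 / 4 * L" using that by (simp add: L_def)
      then show ?thesis using lm(1)[of n] L by linarith
    qed
    then show ?case
      using laplace_eq_interpolate[OF inj _ _ div' eq'] by auto
  qed
  moreover obtain k where "q / lam 0 < (5 / 4) ^ k"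
    using real_arch_pow[of "5/4" "q / lam 0"] by auto
  then have "q \<le> lam 0 * (5 / 4) ^ k" using pos[of 0] by (simp add: field_simps)
  ultimately show ?thesis using q by blast
qed

text \<open>Under the substitution \<open>y = exp (- s)\<close> the values at natural numbers are
  the moments of measures on the unit interval. By Weierstrass they determine the integrals of all
  continuous functions of \<open>y\<close>, and continuous approximations of indicators then give
  the distribution functions.\<close>

lemma eqI_laplace_nat:
  assumes eq: "\<And>k::nat. (\<integral>s. exp (- real k * s) \<partial>M1) = (\<integral>s. exp (- real k * s) \<partial>M2)"
  shows "M1 = M2"
proof -
  define I where "I \<phi> M = (\<integral>s. \<phi> (exp (- s)) \<partial>M)" for \<phi> :: "real \<Rightarrow> real" and M :: "real measure"
  have meas: "(\<lambda>s. \<phi> (exp (- s))) \<in> borel_measurable M"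
    if "finite_borel_measure M" "continuous_on UNIV \<phi>" for M and \<phi> :: "real \<Rightarrow> real"
  proof -
    have "\<phi> \<in> borel_measurable borel" using that(2) by (rule borel_measurable_continuous_onI)
    then show ?thesis
      unfolding measurable_cong_sets[OF finite_borel_measure.M_is_borel[OF that(1)] refl]
      by measurable
  qed
  have in01: "AE s in M. exp (- s) \<in> {0..1}" if "AE s in M. 0 \<le> s" for M :: "real measure"
    using that by eventually_elim auto
  have cont: "I \<phi> M1 = I \<phi> M2" if \<phi>: "continuous_on UNIV \<phi>" for \<phi>
  proof -
    \<comment> \<open>The summand 1 keeps \<open>K\<close> positive when both measures
      vanish.\<close>
    define K where "K = measure M1 (space M1) + measure M2 (space M2) + 1"
    have K: "K > 0" unfolding K_def using measure_nonneg[of M1] measure_nonneg[of M2]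
      by (simp add: add_nonneg_pos)
    have "\<bar>I \<phi> M1 - I \<phi> M2\<bar> \<le> e" if "e > 0" for e
    proof -
      have eK: "0 < e / K" using that K by simp
      obtain p where p: "real_polynomial_function p" "\<And>x. x \<in> {0..1} \<Longrightarrow> \<bar>\<phi> x - p x\<bar> < e / K"
        using Stone_Weierstrass_real_polynomial_function[OF compact_Icc, of 0 1 \<phi> "e / K"]
          continuous_on_subset[OF \<phi> subset_UNIV] eK by blast
      obtain b n where pb: "p = (\<lambda>x. \<Sum>i\<le>n. b i * x ^ i)"
        using p(1) real_polynomial_function_iff_sum by auto
      have *: "\<bar>I \<phi> M - I p M\<bar> \<le> e / K * measure M (space M) \<and>
           I p M = (\<Sum>i\<le>n. b i * (\<integral>s. exp (- real i * s) \<partial>M))"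
        if M: "finite_borel_measure M" "AE s in M. 0 \<le> s" for M
      proof
        interpret finite_borel_measure M by fact
        have i: "integrable M (\<lambda>s. exp (- real i * s))" for i
          using integrable_exp_neg[OF M(2)] by auto
        have pe: "(\<lambda>s. p (exp (- s))) = (\<lambda>s. \<Sum>i\<le>n. b i * exp (- real i * s))"
          unfolding pb by (simp add: exp_of_nat_mult[symmetric])
        have ip: "integrable M (\<lambda>s. p (exp (- s)))"
          unfolding pe by (intro Bochner_Integration.integrable_sum integrable_mult_right i)
        show "I p M = (\<Sum>i\<le>n. b i * (\<integral>s. exp (- real i * s) \<partial>M))"
          unfolding I_def pe using i by (simp add: Bochner_Integration.integral_sum)
        have small: "AE s in M. \<bar>\<phi> (exp (- s)) - p (exp (- s))\<bar> \<le> e / K"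
          using in01[OF M(2)] by eventually_elim (use p(2) in \<open>auto intro: less_imp_le\<close>)
        have mphi: "(\<lambda>s. \<phi> (exp (- s))) \<in> borel_measurable M" by (rule meas[OF M(1) \<phi>])
        \<comment> \<open>Integrability of \<open>\<phi> (exp (- s))\<close> is read off from this
          almost everywhere bounded difference and the integrable polynomial part.\<close>
        have idiff: "integrable M (\<lambda>s. \<phi> (exp (- s)) - p (exp (- s)))"
          by (rule integrable_const_bound[of _ "e / K"])
             (use small mphi borel_measurable_integrable[OF ip] in auto)
        have iphi: "integrable M (\<lambda>s. \<phi> (exp (- s)))"
          using Bochner_Integration.integrable_add[OF idiff ip] by simp
        have "\<bar>I \<phi> M - I p M\<bar> = \<bar>\<integral>s. \<phi> (exp (- s)) - p (exp (- s)) \<partial>M\<bar>"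
          unfolding I_def using iphi ip by simp
        also have "\<dots> \<le> (\<integral>s. \<bar>\<phi> (exp (- s)) - p (exp (- s))\<bar> \<partial>M)" by (rule integral_abs_bound)
        also have "\<dots> \<le> (\<integral>s. e / K \<partial>M)"
          by (intro integral_mono_AE integrable_abs idiff small) auto
        finally show "\<bar>I \<phi> M - I p M\<bar> \<le> e / K * measure M (space M)" by (simp add: mult.commute)
      qed
      note c1 = *[OF M1.finite_borel_measure_axioms nonneg1] and c2 = *[OF M2.finite_borel_measure_axioms nonneg2]
      have "I p M1 = I p M2" using c1 c2 by (simp only: eq)
      then have "\<bar>I \<phi> M1 - I \<phi> M2\<bar> \<le> e / K * measure M1 (space M1) + e / K * measure M2 (space M2)"
        using c1 c2 by linarith
      also have "\<dots> \<le> e / K * K" using \<open>e > 0\<close> K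
        unfolding distrib_left[symmetric] by (intro mult_left_mono) (auto simp: K_def)
      finally show ?thesis using K by simp
    qed
    then show ?thesis using field_le_epsilon[of "\<bar>I \<phi> M1 - I \<phi> M2\<bar>" 0] by auto
  qed
  \<comment> \<open>Here \<open>s \<le> x\<close> means \<open>exp (- x) \<le> exp (- s)\<close>.
    The ramp of the step function ends at \<open>exp (- x)\<close> and shrinks from the left, so the
    endpoint \<open>s = x\<close> gets the value 1, as the closed half-line in \<open>cdf\<close>
    demands.\<close>
  have lim: "(\<lambda>n. I (\<lambda>y. 1 - cts_step (exp (- x) - inverse (real (Suc n))) (exp (- x)) y) M) \<longlonglongrightarrow> cdf M x"
    if M: "finite_borel_measure M" for M x
  proof -
    interpret finite_borel_measure M by fact
    have sp: "space M = UNIV" using sets_eq_imp_space_eq[OF M_is_borel] by simp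
    have cts_step_le: "norm (1 - cts_step a b y) \<le> 1" if "a < b" for a b y
      using that by (auto simp: cts_step_def divide_simps)
    have "(\<lambda>n. I (\<lambda>y. 1 - cts_step (exp (- x) - inverse (real (Suc n))) (exp (- x)) y) M)
       \<longlonglongrightarrow> (\<integral>s. indicator {..x} s \<partial>M)"
      unfolding I_def
    proof (rule integral_dominated_convergence[where w = "\<lambda>_. 1"])
      show "indicator {..x} \<in> borel_measurable M" by (simp add: measurable_cong_sets[OF M_is_borel refl])
      show "(\<lambda>s. 1 - cts_step (exp (- x) - inverse (real (Suc n))) (exp (- x)) (exp (- s))) \<in> borel_measurable M"
        for n
        by (rule meas[OF M]) (intro continuous_intros uniformly_continuous_imp_continuous
              cts_step_uniformly_continuous, simp)
      show "AE s in M. norm (1 - cts_step (exp (- x) - inverse (real (Suc n))) (exp (- x)) (exp (- s))) \<le> 1" for n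
        by (intro AE_I2 cts_step_le) simp
      show "AE s in M. (\<lambda>n. 1 - cts_step (exp (- x) - inverse (real (Suc n))) (exp (- x)) (exp (- s)))
          \<longlonglongrightarrow> indicator {..x} s"
      proof (intro AE_I2)
        fix s
        show "(\<lambda>n. 1 - cts_step (exp (- x) - inverse (real (Suc n))) (exp (- x)) (exp (- s)))
          \<longlonglongrightarrow> indicator {..x} s"
        proof (cases "s \<le> x")
          case True
          then have le: "exp (- x) \<le> exp (- s)" by simp
          have "cts_step (exp (- x) - inverse (real (Suc n))) (exp (- x)) (exp (- s)) = 0" for n
          proof -
            have "inverse (real (Suc n)) > 0" by simp
            then have "\<not> exp (- s) \<le> exp (- x) - inverse (real (Suc n))" using le by linarith
            then show ?thesis using le by (simp add: cts_step_def del: of_nat_Suc)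
          qed
          then show ?thesis using True by simp
        next
          case False
          have "(\<lambda>n. exp (- x) - inverse (real (Suc n))) \<longlonglongrightarrow> exp (- x) - 0"
            by (intro tendsto_intros LIMSEQ_inverse_real_of_nat)
          moreover have "exp (- s) < exp (- x) - 0" using False by simp
          ultimately have "\<forall>\<^sub>F n in sequentially. exp (- s) < exp (- x) - inverse (real (Suc n))"
            by (rule order_tendstoD)
          then have "\<forall>\<^sub>F n in sequentially.
            1 - cts_step (exp (- x) - inverse (real (Suc n))) (exp (- x)) (exp (- s)) = indicator {..x} s"
            by eventually_elim (use False in \<open>auto simp: cts_step_def\<close>)
          then show ?thesis by (rule tendsto_eventually)
        qed
      qed
    qed simp
    then show ?thesis by (simp add: cdf_def sp)
  qed
  have "cdf M1 = cdf M2"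
  proof
    fix x
    have "I (\<lambda>y. 1 - cts_step (exp (- x) - inverse (real (Suc n))) (exp (- x)) y) M1 =
        I (\<lambda>y. 1 - cts_step (exp (- x) - inverse (real (Suc n))) (exp (- x)) y) M2" for n
      by (rule cont) (intro continuous_intros uniformly_continuous_imp_continuous
              cts_step_uniformly_continuous, simp)
    then show "cdf M1 x = cdf M2 x"
      using lim[OF M1.finite_borel_measure_axioms, of x] lim[OF M2.finite_borel_measure_axioms, of x]
      by (simp add: LIMSEQ_unique)
  qed
  then show ?thesis
    by (intro cdf_unique' M1.finite_borel_measure_axioms M2.finite_borel_measure_axioms)
qed

end

section \<open>From finite measures to measures with a finite Laplace transform\<close>

text \<open>Multiplying both measures by the density \<open>exp (- c * s)\<close> with
  \<open>c = lam 0\<close> makes them finite and shifts the transforms by \<open>c\<close>. The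
  shifted nodes are smaller, so their reciprocals still diverge, and the density is
  invertible.\<close>

lemma measure_eqI_laplace_seq:
  fixes M1 M2 :: "real measure" and lam :: "nat \<Rightarrow> real"
  assumes sets: "sets M1 = sets borel" "sets M2 = sets borel"
    and nonneg: "AE s in M1. 0 \<le> s" "AE s in M2. 0 \<le> s"
    and mono: "strict_mono lam" and pos: "\<And>n. 0 < lam n"
    and div: "\<not> summable (\<lambda>n. 1 / lam n)"
    and eq: "\<And>n. (\<integral>\<^sup>+s. ennreal (exp (- lam n * s)) \<partial>M1) = (\<integral>\<^sup>+s. ennreal (exp (- lam n * s)) \<partial>M2)"
    and fin: "\<And>n. (\<integral>\<^sup>+s. ennreal (exp (- lam n * s)) \<partial>M1) < \<infinity>"
  shows "M1 = M2"
proof -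
  define c where "c = lam 0"
  define T where "T M = density M (\<lambda>s. ennreal (exp (- c * s)))" for M :: "real measure"
  \<comment> \<open>Starting at \<open>Suc n\<close> makes every shifted node positive; the node
    \<open>lam 0\<close> itself is kept for the argument 0.\<close>
  define lam' where "lam' n = lam (Suc n) - c" for n
  have T: "finite_borel_measure (T M)" "AE s in T M. 0 \<le> s"
      "\<And>r. (\<integral>s. exp (- r * s) \<partial>T M) = enn2real (\<integral>\<^sup>+s. ennreal (exp (- (c + r) * s)) \<partial>M)"
      "density (T M) (\<lambda>s. ennreal (exp (c * s))) = M"
    if M: "sets M = sets borel" "AE s in M. 0 \<le> s" "(\<integral>\<^sup>+s. ennreal (exp (- c * s)) \<partial>M) < \<infinity>" for M
  proof -
    note [measurable_cong] = M(1)
    have sp: "space M = UNIV" using sets_eq_imp_space_eq[OF M(1)] by simp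
    show "finite_borel_measure (T M)"
    proof (intro finite_borel_measure.intro finite_measureI finite_borel_measure_axioms.intro)
      show "emeasure (T M) (space (T M)) \<noteq> \<infinity>"
        using M(3) by (simp add: T_def emeasure_density sp)
      show "sets (T M) = sets borel" by (simp add: T_def M(1))
    qed
    show "AE s in T M. 0 \<le> s" using M(2) unfolding T_def by (subst AE_density) auto
    show "(\<integral>s. exp (- r * s) \<partial>T M) = enn2real (\<integral>\<^sup>+s. ennreal (exp (- (c + r) * s)) \<partial>M)" for r
    proof -
      have "(\<integral>s. exp (- r * s) \<partial>T M) = enn2real (\<integral>\<^sup>+s. ennreal (exp (- r * s)) \<partial>T M)"
        by (rule integral_eq_nn_integral) (auto simp: T_def)
      also have "(\<integral>\<^sup>+s. ennreal (exp (- r * s)) \<partial>T M) =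
          (\<integral>\<^sup>+s. ennreal (exp (- c * s)) * ennreal (exp (- r * s)) \<partial>M)"
        unfolding T_def by (subst nn_integral_density) auto
      also have "\<dots> = (\<integral>\<^sup>+s. ennreal (exp (- (c + r) * s)) \<partial>M)"
        by (intro nn_integral_cong) (simp add: ennreal_mult[symmetric] exp_add[symmetric] algebra_simps)
      finally show ?thesis .
    qed
    have "density (T M) (\<lambda>s. ennreal (exp (c * s))) =
        density M (\<lambda>s. ennreal (exp (- c * s)) * ennreal (exp (c * s)))"
      unfolding T_def by (rule density_density_eq) auto
    also have "(\<lambda>s. ennreal (exp (- c * s)) * ennreal (exp (c * s))) = (\<lambda>s. 1)"
      by (simp add: ennreal_mult[symmetric] exp_add[symmetric])
    finally show "density (T M) (\<lambda>s. ennreal (exp (c * s))) = M" by (simp add: density_1)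
  qed
  have fin1: "(\<integral>\<^sup>+s. ennreal (exp (- c * s)) \<partial>M1) < \<infinity>" using fin[of 0] by (simp add: c_def)
  then have fin2: "(\<integral>\<^sup>+s. ennreal (exp (- c * s)) \<partial>M2) < \<infinity>" using eq[of 0] by (simp add: c_def)
  note T1 = T[OF sets(1) nonneg(1) fin1] and T2 = T[OF sets(2) nonneg(2) fin2]
  interpret finite_borel_measure_pair "T M1" "T M2"
    using T1 T2 by (simp add: finite_borel_measure_pair_def finite_borel_measure_pair_axioms_def)
  have lam': "strict_mono lam'" "lam' n > 0" for n
    using mono by (auto simp: lam'_def c_def strict_mono_def)
  have div': "\<not> summable (\<lambda>n. 1 / lam' n)"
  proof
    assume "summable (\<lambda>n. 1 / lam' n)"
    moreover have "norm (1 / lam (Suc n)) \<le> 1 / lam' n" for n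
      using lam'(2)[of n] pos[of 0] pos[of "Suc n"] unfolding lam'_def c_def
      by (auto intro!: divide_left_mono mult_pos_pos)
    ultimately have "summable (\<lambda>n. 1 / lam (Suc n))" by (rule summable_comparison_test'[where N = 0])
    then show False using div summable_Suc_iff[of "\<lambda>n. 1 / lam n"] by simp
  qed
  have c_lam: "c + lam' n = lam (Suc n)" for n by (simp add: lam'_def)
  have "(\<integral>s. exp (- lam' n * s) \<partial>T M1) = (\<integral>s. exp (- lam' n * s) \<partial>T M2)" for n
    unfolding T1(3) T2(3) c_lam eq ..
  note ext = laplace_eq_extend[OF lam' div' this]
  \<comment> \<open>For \<open>k = 0\<close> the claim compares the total masses, which are the
    original transforms at \<open>lam 0\<close>.\<close>
  have "(\<integral>s. exp (- real k * s) \<partial>T M1) = (\<integral>s. exp (- real k * s) \<partial>T M2)" for k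
  proof (cases "k = 0")
    case True
    have "c + real 0 = lam 0" by (simp add: c_def)
    then show ?thesis unfolding T1(3) T2(3) True using eq[of 0] by simp
  qed (use ext in auto)
  then have "T M1 = T M2" by (rule eqI_laplace_nat)
  with T1(4) T2(4) show ?thesis by metis
qed

section \<open>Uniqueness for completely monotone kernels\<close>

text \<open>Turns identities that hold only almost everywhere into identities along chosen sequences
  of points.\<close>

lemma AE_obtain:
  assumes "AE x in M. P x" "U \<in> sets M" "0 < emeasure M U"
  obtains x where "x \<in> U" "P x"
proof (rule ccontr)
  assume "\<not> thesis"
  with that have "AE x in M. x \<notin> U" using assms(1) by (auto elim: eventually_mono)
  then have "emeasure M U = 0" using AE_iff_null_sets[OF assms(2)] by (simp add: null_setsD1)
  with assms(3) show False by simp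
qed

text \<open>Tonelli: for \<open>s \<ge> 0\<close> also \<open>t + s > a\<close>, so the
  representation of \<open>f\<close> applies under the integral. The right side is the transform at
  \<open>t\<close> of \<nu> weighted by the transform of \<open>M\<close>.\<close>

lemma nn_integral_cm_kernel:
  fixes f :: "real \<Rightarrow> real"
  assumes M: "sigma_finite_measure M" "sets M = sets borel" "AE s in M. 0 \<le> s"
    and nu: "sigma_finite_measure \<nu>" "sets \<nu> = sets borel"
    and f_cm: "\<forall>t>a. ennreal (f t) = (\<integral>\<^sup>+ u. ennreal (exp (- u * t)) \<partial>\<nu>)"
    and t: "t > a"
  shows "(\<integral>\<^sup>+ s. ennreal (f (t + s)) \<partial>M) =
     (\<integral>\<^sup>+ u. (\<integral>\<^sup>+ s. ennreal (exp (- u * s)) \<partial>M) * ennreal (exp (- t * u)) \<partial>\<nu>)"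
proof -
  note [measurable_cong] = M(2) nu(2)
  interpret M: sigma_finite_measure M by fact
  interpret nu: sigma_finite_measure \<nu> by fact
  interpret pair_sigma_finite M \<nu> ..
  have "(\<integral>\<^sup>+ s. ennreal (f (t + s)) \<partial>M) = (\<integral>\<^sup>+ s. \<integral>\<^sup>+ u. ennreal (exp (- u * (t + s))) \<partial>\<nu> \<partial>M)"
    using M(3) by (intro nn_integral_cong_AE, eventually_elim) (use t f_cm in simp)
  also have "\<dots> = (\<integral>\<^sup>+ u. \<integral>\<^sup>+ s. ennreal (exp (- u * (t + s))) \<partial>M \<partial>\<nu>)"
    by (rule Fubini'[symmetric]) measurable
  also have "\<dots> = (\<integral>\<^sup>+ u. \<integral>\<^sup>+ s. ennreal (exp (- u * s)) * ennreal (exp (- t * u)) \<partial>M \<partial>\<nu>)"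
    by (intro nn_integral_cong) (simp add: ennreal_mult[symmetric] exp_add[symmetric] algebra_simps)
  also have "\<dots> = (\<integral>\<^sup>+ u. (\<integral>\<^sup>+ s. ennreal (exp (- u * s)) \<partial>M) * ennreal (exp (- t * u)) \<partial>\<nu>)"
    by (intro nn_integral_cong nn_integral_multc) measurable
  finally show ?thesis .
qed

text \<open>On \<open>{..real n}\<close> the integrand is at least
  \<open>exp (- real n * t)\<close>, so each of these sets has finite mass. Tonelli and the
  uniqueness of densities with respect to \<nu> rest on this.\<close>

lemma sigma_finite_measure_laplace:
  fixes \<nu> :: "real measure"
  assumes sets: "sets \<nu> = sets borel" and t: "0 < t"
    and fin: "(\<integral>\<^sup>+ u. ennreal (exp (- u * t)) \<partial>\<nu>) < \<infinity>"
  shows "sigma_finite_measure \<nu>"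
proof
  note [measurable_cong] = sets
  have "emeasure \<nu> {..real n} \<noteq> \<infinity>" for n
  proof -
    have "emeasure \<nu> {..real n} = (\<integral>\<^sup>+ u. indicator {..real n} u \<partial>\<nu>)"
      by (simp add: sets)
    also have "\<dots> \<le> (\<integral>\<^sup>+ u. ennreal (exp (real n * t)) * ennreal (exp (- u * t)) \<partial>\<nu>)"
      using t by (intro nn_integral_mono)
        (auto simp: ennreal_mult[symmetric] exp_add[symmetric] ennreal_1[symmetric]
          simp del: ennreal_1 intro!: ennreal_leI split: split_indicator)
    also have "\<dots> = ennreal (exp (real n * t)) * (\<integral>\<^sup>+ u. ennreal (exp (- u * t)) \<partial>\<nu>)"
      by (rule nn_integral_cmult) measurable
    also have "\<dots> < \<infinity>" using fin by (simp add: ennreal_mult_less_top)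
    finally show ?thesis by simp
  qed
  moreover have "(\<Union>n. {..real n}) = UNIV" using real_arch_simple by auto
  ultimately show "\<exists>A. countable A \<and> A \<subseteq> sets \<nu> \<and> \<Union> A = space \<nu> \<and> (\<forall>a\<in>A. emeasure \<nu> a \<noteq> \<infinity>)"
    using sets_eq_imp_space_eq[OF sets] by (intro exI[of _ "range (\<lambda>n. {..real n})"]) (auto simp: sets)
qed

text \<open>Laplace uniqueness is used twice: first in the variable \<open>t\<close> for the
  weighted measures \<open>density \<nu> L1\<close> and \<open>density \<nu> L2\<close>, which gives
  \<open>L1 = L2\<close> \<nu>-almost everywhere, then in the variable \<open>u\<close> for
  \<open>M1\<close> and \<open>M2\<close>. Equality is assumed for almost every \<open>t\<close>
  because convolution identities provide no more.\<close>

lemma measure_eqI_cm_kernel: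
  fixes f :: "real \<Rightarrow> real" and \<nu> M1 M2 :: "real measure" and as :: "nat \<Rightarrow> real"
  assumes a_nonneg: "a \<ge> 0"
    and nu_sets: "sets \<nu> = sets borel"
    and nu_pos: "emeasure \<nu> {..0} = 0"
    and f_cm: "\<forall>t>a. ennreal (f t) = (\<integral>\<^sup>+ u. ennreal (exp (- u * t)) \<partial>\<nu>)"
    and as_mono: "strict_mono as"
    and as_supp: "\<And>n. as n \<in> measure_support \<nu>"
    and as_div: "\<not> summable (\<lambda>n. 1 / as n)"
    and M1: "sigma_finite_measure M1" "sets M1 = sets borel" "AE s in M1. 0 \<le> s"
    and M2: "sigma_finite_measure M2" "sets M2 = sets borel" "AE s in M2. 0 \<le> s"
    and eq: "AE t in lborel. t > a \<longrightarrow>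
      (\<integral>\<^sup>+ s. ennreal (f (t + s)) \<partial>M1) = (\<integral>\<^sup>+ s. ennreal (f (t + s)) \<partial>M2) \<and>
      (\<integral>\<^sup>+ s. ennreal (f (t + s)) \<partial>M1) < \<infinity>"
  shows "M1 = M2"
proof -
  note [measurable_cong] = nu_sets M1(2) M2(2)
  interpret M1: sigma_finite_measure M1 by fact
  interpret M2: sigma_finite_measure M2 by fact
  have sf: "sigma_finite_measure \<nu>"
  proof (rule sigma_finite_measure_laplace[OF nu_sets])
    show "0 < a + 1" using a_nonneg by simp
    show "(\<integral>\<^sup>+ u. ennreal (exp (- u * (a + 1))) \<partial>\<nu>) < \<infinity>"
      using f_cm[rule_format, of "a + 1", symmetric] by simp
  qed
  interpret nu: sigma_finite_measure \<nu> by fact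
  have nu_AE: "AE u in \<nu>. 0 < u"
    using nu_pos by (intro AE_I[of _ _ "{..0}"]) (auto simp: nu_sets)
  define L1 where "L1 u = (\<integral>\<^sup>+ s. ennreal (exp (- u * s)) \<partial>M1)" for u
  define L2 where "L2 u = (\<integral>\<^sup>+ s. ennreal (exp (- u * s)) \<partial>M2)" for u
  have L1[measurable]: "L1 \<in> borel_measurable borel" unfolding L1_def by measurable
  have L2[measurable]: "L2 \<in> borel_measurable borel" unfolding L2_def by measurable
  have lap1: "(\<integral>\<^sup>+ u. ennreal (exp (- t * u)) \<partial>density \<nu> L1) = (\<integral>\<^sup>+ s. ennreal (f (t + s)) \<partial>M1)"
    if "t > a" for t
    unfolding nn_integral_cm_kernel[OF M1 sf nu_sets f_cm that] L1_def[symmetric]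
    by (subst nn_integral_density) auto
  have lap2: "(\<integral>\<^sup>+ u. ennreal (exp (- t * u)) \<partial>density \<nu> L2) = (\<integral>\<^sup>+ s. ennreal (f (t + s)) \<partial>M2)"
    if "t > a" for t
    unfolding nn_integral_cm_kernel[OF M2 sf nu_sets f_cm that] L2_def[symmetric]
    by (subst nn_integral_density) auto

  \<comment> \<open>The points increase from \<open>a + 1\<close> towards \<open>a + 2\<close>. One
    good \<open>t n\<close> chosen in each gap gives a bounded increasing sequence, whose
    reciprocals therefore have a divergent sum.\<close>
  define b where "b n = a + 2 - 1 / (real n + 1)" for n
  have b: "b n < b (Suc n)" "a + 1 \<le> b n" "b n < a + 2" for n
    by (auto simp: b_def field_simps)
  have "\<exists>t\<in>{b n<..<b (Suc n)}.
      (\<integral>\<^sup>+ s. ennreal (f (t + s)) \<partial>M1) = (\<integral>\<^sup>+ s. ennreal (f (t + s)) \<partial>M2) \<and>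
      (\<integral>\<^sup>+ s. ennreal (f (t + s)) \<partial>M1) < \<infinity>" for n
  proof -
    obtain t where "t \<in> {b n<..<b (Suc n)}" "t > a \<longrightarrow>
      (\<integral>\<^sup>+ s. ennreal (f (t + s)) \<partial>M1) = (\<integral>\<^sup>+ s. ennreal (f (t + s)) \<partial>M2) \<and>
      (\<integral>\<^sup>+ s. ennreal (f (t + s)) \<partial>M1) < \<infinity>"
      by (rule AE_obtain[OF eq, of "{b n<..<b (Suc n)}"]) (use b[of n] in auto)
    then show ?thesis using b(2)[of n] by (intro bexI[of _ t]) auto
  qed
  then obtain t where t: "\<And>n. b n < t n" "\<And>n. t n < b (Suc n)"
     and t_eq: "\<And>n. (\<integral>\<^sup>+ s. ennreal (f (t n + s)) \<partial>M1) = (\<integral>\<^sup>+ s. ennreal (f (t n + s)) \<partial>M2)"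
     and t_fin: "\<And>n. (\<integral>\<^sup>+ s. ennreal (f (t n + s)) \<partial>M1) < \<infinity>"
    unfolding Bex_def by (metis greaterThanLessThan_iff)
  have ta: "t n > a" "t n > 0" "t n < a + 2" for n
    using t(1)[of n] t(2)[of n] b[of n] b[of "Suc n"] a_nonneg by linarith+
  have dens: "density \<nu> L1 = density \<nu> L2"
  proof (rule measure_eqI_laplace_seq)
    show "AE u in density \<nu> L1. 0 \<le> u" "AE u in density \<nu> L2. 0 \<le> u"
      using nu_AE by (auto simp: AE_density elim: eventually_mono)
    show "strict_mono t" unfolding strict_mono_Suc_iff using t by (meson order_less_trans)
    show "\<not> summable (\<lambda>n. 1 / t n)"
    proof
      assume "summable (\<lambda>n. 1 / t n)"
      moreover have "norm (1 / (a + 2)) \<le> 1 / t n" for n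
        using ta[of n] a_nonneg by (auto intro!: divide_left_mono mult_pos_pos)
      ultimately have "summable (\<lambda>n::nat. 1 / (a + 2))" by (rule summable_comparison_test'[where N = 0])
      then show False using a_nonneg by (simp add: summable_const_iff)
    qed
    show "(\<integral>\<^sup>+ u. ennreal (exp (- t n * u)) \<partial>density \<nu> L1) = (\<integral>\<^sup>+ u. ennreal (exp (- t n * u)) \<partial>density \<nu> L2)"
        "(\<integral>\<^sup>+ u. ennreal (exp (- t n * u)) \<partial>density \<nu> L1) < \<infinity>" for n
      using t_eq[of n] t_fin[of n] by (simp_all only: lap1 lap2 ta)
  qed (auto simp: nu_sets ta)
  have "AE u in \<nu>. L1 u = L2 u"
    using dens by (subst (asm) nu.density_unique_iff) auto
  \<comment> \<open>Finite transforms at the nodes are required in the second use of Laplace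
    uniqueness; here they come from the finite integral at \<open>t 0\<close>.\<close>
  moreover have "AE u in \<nu>. L1 u < \<infinity>"
  proof -
    have "(\<integral>\<^sup>+ u. L1 u * ennreal (exp (- t 0 * u)) \<partial>\<nu>) \<noteq> \<infinity>"
      using t_fin[of 0] by (simp add: nn_integral_cm_kernel[OF M1 sf nu_sets f_cm ta(1)] L1_def)
    then have "AE u in \<nu>. L1 u * ennreal (exp (- t 0 * u)) \<noteq> \<infinity>"
      by (rule nn_integral_PInf_AE[rotated]) measurable
    then show ?thesis by eventually_elim (auto simp: ennreal_mult_eq_top_iff less_top)
  qed
  ultimately have L_AE: "AE u in \<nu>. L1 u = L2 u \<and> L1 u < \<infinity>" by eventually_elim auto

  have as_nonneg: "as n \<ge> 0" for n
  proof (rule ccontr)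
    assume "\<not> as n \<ge> 0"
    then have "emeasure \<nu> {..<0} > 0"
      using as_supp[of n] by (auto simp: measure_support_def)
    moreover have "emeasure \<nu> {..<0} \<le> emeasure \<nu> {..0}"
      by (rule emeasure_mono) (auto simp: nu_sets)
    ultimately show False using nu_pos by simp
  qed
  have as_less: "as n < as (Suc n)" for n using as_mono by (simp add: strict_mono_Suc_iff)
  \<comment> \<open>The interval between consecutive midpoints is a neighbourhood of
    \<open>as (Suc n)\<close>, hence has positive \<nu>-mass and contains a good point
    \<open>u n\<close>. Beginning with \<open>as 1\<close> keeps \<open>u n\<close> positive even if
    \<open>as 0 = 0\<close>.\<close>
  define m where "m n = (as n + as (Suc n)) / 2" for n
  have "\<exists>u\<in>{m n<..<m (Suc n)}. L1 u = L2 u \<and> L1 u < \<infinity>" for n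
  proof -
    have "as (Suc n) \<in> {m n<..<m (Suc n)}"
      using as_less[of n] as_less[of "Suc n"] by (auto simp: m_def)
    then have pos: "emeasure \<nu> {m n<..<m (Suc n)} > 0"
      using as_supp[of "Suc n"] open_greaterThanLessThan unfolding measure_support_def mem_Collect_eq by metis
    have "{m n<..<m (Suc n)} \<in> sets \<nu>" by (simp add: nu_sets)
    from AE_obtain[OF L_AE this pos]
    obtain u where "u \<in> {m n<..<m (Suc n)}" "L1 u = L2 u \<and> L1 u < \<infinity>" .
    then show ?thesis by (rule bexI[rotated])
  qed
  then obtain u where u: "\<And>n. m n < u n" "\<And>n. u n < m (Suc n)"
     and u_eq: "\<And>n. L1 (u n) = L2 (u n)" and u_fin: "\<And>n. L1 (u n) < \<infinity>"
    unfolding Bex_def by (metis greaterThanLessThan_iff)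
  have u_pos: "u n > 0" for n
    using u(1)[of n] as_nonneg[of n] as_less[of n] by (simp add: m_def)
  show ?thesis
  proof (rule measure_eqI_laplace_seq[OF M1(2) M2(2) M1(3) M2(3) _ u_pos])
    show "strict_mono u" unfolding strict_mono_Suc_iff using u by (meson order_less_trans)
    show "\<not> summable (\<lambda>n. 1 / u n)"
    proof
      assume "summable (\<lambda>n. 1 / u n)"
      \<comment> \<open>Each \<open>u n\<close> lies below \<open>as (n + 2)\<close>, and shifting
        the index by 2 does not affect divergence.\<close>
      moreover have "norm (1 / as (n + 2)) \<le> 1 / u n" for n
      proof -
        have "u n < as (n + 2)" using u(2)[of n] as_less[of "Suc n"] by (simp add: m_def)
        then show ?thesis using u_pos[of n] by (auto intro!: divide_left_mono mult_pos_pos)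
      qed
      ultimately have "summable (\<lambda>n. 1 / as (n + 2))" by (rule summable_comparison_test'[where N = 0])
      then show False using as_div summable_iff_shift[of "\<lambda>n. 1 / as n" 2] by simp
    qed
  qed (use u_eq u_fin in \<open>simp_all add: L1_def L2_def\<close>)
qed

section \<open>The convolution square on the half-line\<close>

text \<open>A sum of two negative numbers is never in \<open>A\<close>, so the term with
  \<open>N\<close> twice vanishes; the two mixed terms agree by Tonelli and commutativity of
  addition.\<close>

lemma convolution_self_split:
  fixes M :: "real measure"
  assumes fin: "finite_measure M" and sets: "sets M = sets borel"
    and A: "A \<in> sets borel" "A \<subseteq> {0..}"
  defines "P \<equiv> density M (indicator {0..})" and "N \<equiv> density M (indicator {..<0})"
  shows "emeasure (M \<star> M) A =
    (\<integral>\<^sup>+x. \<integral>\<^sup>+y. indicator A (x + y) \<partial>P \<partial>P) + 2 * (\<integral>\<^sup>+x. \<integral>\<^sup>+y. indicator A (x + y) \<partial>P \<partial>N)"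
proof -
  note [measurable_cong] = sets and [measurable] = A(1)
  have setsPN[measurable_cong]: "sets P = sets borel" "sets N = sets borel"
    by (simp_all add: P_def N_def sets)
  interpret M: finite_measure M by fact
  interpret P: finite_measure P unfolding P_def by (rule M.finite_measure_restricted) (simp add: sets)
  interpret N: finite_measure N unfolding N_def by (rule M.finite_measure_restricted) (simp add: sets)
  interpret NP: pair_sigma_finite N P ..
  have split: "(\<integral>\<^sup>+x. h x \<partial>M) = (\<integral>\<^sup>+x. h x \<partial>P) + (\<integral>\<^sup>+x. h x \<partial>N)"
    if [measurable]: "h \<in> borel_measurable borel" for h
    unfolding P_def N_def by (subst (1 2) nn_integral_density)
      (auto simp flip: nn_integral_add intro!: nn_integral_cong split: split_indicator)
  have NN: "(\<integral>\<^sup>+x. \<integral>\<^sup>+y. indicator A (x + y) \<partial>N \<partial>N) = 0"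
  proof -
    have neg: "AE x in N. x < 0" unfolding N_def by (subst AE_density) (auto split: split_indicator)
    have inner: "(\<integral>\<^sup>+y. indicator A (x + y) \<partial>N) = 0" if "x < 0" for x
    proof -
      have "(\<integral>\<^sup>+y. indicator A (x + y) \<partial>N) = (\<integral>\<^sup>+y. 0 \<partial>N)"
        using neg by (intro nn_integral_cong_AE, eventually_elim)
          (use A(2) that in \<open>force split: split_indicator\<close>)
      then show ?thesis by simp
    qed
    have "(\<integral>\<^sup>+x. \<integral>\<^sup>+y. indicator A (x + y) \<partial>N \<partial>N) = (\<integral>\<^sup>+x. 0 \<partial>N)"
      using neg by (intro nn_integral_cong_AE, eventually_elim) (rule inner)
    then show ?thesis by simp
  qed
  have PN: "(\<integral>\<^sup>+x. \<integral>\<^sup>+y. indicator A (x + y) \<partial>N \<partial>P) = (\<integral>\<^sup>+x. \<integral>\<^sup>+y. indicator A (x + y) \<partial>P \<partial>N)"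
    using NP.Fubini'[of "\<lambda>x y. indicator A (x + y)"] by (simp add: add.commute)
  have "emeasure (M \<star> M) A = (\<integral>\<^sup>+x. \<integral>\<^sup>+y. indicator A (x + y) \<partial>M \<partial>M)"
    by (rule convolution_emeasure') (auto simp: A fin sets)
  also have "\<dots> = (\<integral>\<^sup>+x. (\<integral>\<^sup>+y. indicator A (x + y) \<partial>P) + (\<integral>\<^sup>+y. indicator A (x + y) \<partial>N) \<partial>M)"
    by (intro nn_integral_cong split) measurable
  also have "\<dots> = (\<integral>\<^sup>+x. \<integral>\<^sup>+y. indicator A (x + y) \<partial>P \<partial>M) + (\<integral>\<^sup>+x. \<integral>\<^sup>+y. indicator A (x + y) \<partial>N \<partial>M)"
    by (intro nn_integral_add) measurable
  also have "(\<integral>\<^sup>+x. \<integral>\<^sup>+y. indicator A (x + y) \<partial>P \<partial>M) =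
      (\<integral>\<^sup>+x. \<integral>\<^sup>+y. indicator A (x + y) \<partial>P \<partial>P) + (\<integral>\<^sup>+x. \<integral>\<^sup>+y. indicator A (x + y) \<partial>P \<partial>N)"
    by (intro split) measurable
  also have "(\<integral>\<^sup>+x. \<integral>\<^sup>+y. indicator A (x + y) \<partial>N \<partial>M) =
      (\<integral>\<^sup>+x. \<integral>\<^sup>+y. indicator A (x + y) \<partial>N \<partial>P) + (\<integral>\<^sup>+x. \<integral>\<^sup>+y. indicator A (x + y) \<partial>N \<partial>N)"
    by (intro split) measurable
  finally show ?thesis unfolding NN PN by (simp add: mult_2 add.assoc)
qed

text \<open>If \<open>x < 0\<close> and \<open>x + y \<ge> 0\<close> then \<open>y \<ge> 0\<close>,
  so the restriction of the density to \<open>{0..}\<close> may be dropped. Translating by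
  \<open>x\<close> and exchanging integrals exhibits the density of the mixed convolution on the
  half-line.\<close>

lemma nn_integral_cross_term:
  fixes f :: "real \<Rightarrow> real"
  assumes f[measurable]: "f \<in> borel_measurable borel"
    and N: "finite_measure N" "sets N = sets borel" "AE x in N. x < 0"
    and A: "A \<in> sets borel" "A \<subseteq> {0..}"
  shows "(\<integral>\<^sup>+x. \<integral>\<^sup>+y. indicator A (x + y) \<partial>density (density lborel (\<lambda>x. ennreal (f x))) (indicator {0..}) \<partial>N) =
    (\<integral>\<^sup>+t. (\<integral>\<^sup>+x. ennreal (f (t - x)) \<partial>N) * indicator A t \<partial>lborel)"
proof -
  note [measurable_cong] = N(2) and [measurable] = A(1)
  interpret N: finite_measure N by fact
  interpret pair_sigma_finite N lborel ..
  have inner: "(\<integral>\<^sup>+y. indicator A (x + y) \<partial>density (density lborel (\<lambda>x. ennreal (f x))) (indicator {0..})) =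
      (\<integral>\<^sup>+t. ennreal (f (t - x)) * indicator A t \<partial>lborel)" if "x < 0" for x
  proof -
    have "(\<integral>\<^sup>+y. indicator A (x + y) \<partial>density (density lborel (\<lambda>x. ennreal (f x))) (indicator {0..})) =
       (\<integral>\<^sup>+y. ennreal (f y) * (indicator {0..} y * indicator A (x + y)) \<partial>lborel)"
      by (simp add: nn_integral_density)
    also have "\<dots> = (\<integral>\<^sup>+y. ennreal (f y) * indicator A (x + y) \<partial>lborel)"
      using A(2) that by (intro nn_integral_cong) (force split: split_indicator)
    also have "\<dots> = (\<integral>\<^sup>+t. ennreal (f (t - x)) * indicator A t \<partial>lborel)"
      using nn_integral_real_affine[of "\<lambda>y. ennreal (f y) * indicator A (x + y)" 1 "- x"] by simp
    finally show ?thesis .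
  qed
  have "(\<integral>\<^sup>+x. \<integral>\<^sup>+y. indicator A (x + y) \<partial>density (density lborel (\<lambda>x. ennreal (f x))) (indicator {0..}) \<partial>N) =
    (\<integral>\<^sup>+x. \<integral>\<^sup>+t. ennreal (f (t - x)) * indicator A t \<partial>lborel \<partial>N)"
    using N(3) by (intro nn_integral_cong_AE, eventually_elim) (rule inner)
  also have "\<dots> = (\<integral>\<^sup>+t. \<integral>\<^sup>+x. ennreal (f (t - x)) * indicator A t \<partial>N \<partial>lborel)"
    by (rule Fubini'[symmetric]) measurable
  also have "\<dots> = (\<integral>\<^sup>+t. (\<integral>\<^sup>+x. ennreal (f (t - x)) \<partial>N) * indicator A t \<partial>lborel)"
    by (intro nn_integral_cong nn_integral_multc) measurable
  finally show ?thesis .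
qed

lemma density_indicator_eqI:
  assumes "sets M1 = sets M2" "S \<in> sets M2"
    and "\<And>A. A \<in> sets M2 \<Longrightarrow> A \<subseteq> S \<Longrightarrow> emeasure M1 A = emeasure M2 A"
  shows "density M1 (indicator S) = density M2 (indicator S)"
  by (rule measure_eqI) (use assms in \<open>auto simp: emeasure_restricted\<close>)

text \<open>The squares share the term built from the common nonnegative part. Cancelling it leaves
  mixed terms whose densities have equal integrals over every Borel subset of \<open>{0..}\<close>,
  so they agree almost everywhere; they are finite almost everywhere because their integrals are
  finite.\<close>

lemma convolution_square_AE_kernel:
  fixes f :: "real \<Rightarrow> real" and \<mu> \<mu>1 :: "real measure"
  assumes f[measurable]: "f \<in> borel_measurable borel"
    and \<mu>: "\<mu> = density lborel (\<lambda>x. ennreal (f x))" "prob_space \<mu>"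
    and \<mu>1: "prob_space \<mu>1" "sets \<mu>1 = sets borel"
    and eq: "\<And>A. A \<in> sets borel \<Longrightarrow> A \<subseteq> {0..} \<Longrightarrow> emeasure \<mu>1 A = emeasure \<mu> A"
    and eq2: "\<And>A. A \<in> sets borel \<Longrightarrow> A \<subseteq> {0..} \<Longrightarrow> emeasure (\<mu>1 \<star> \<mu>1) A = emeasure (\<mu> \<star> \<mu>) A"
  defines "N1 \<equiv> density \<mu>1 (indicator {..<0})" and "N \<equiv> density \<mu> (indicator {..<0})"
  shows "AE t in lborel. 0 \<le> t \<longrightarrow>
    (\<integral>\<^sup>+ x. ennreal (f (t - x)) \<partial>N1) = (\<integral>\<^sup>+ x. ennreal (f (t - x)) \<partial>N) \<and>
    (\<integral>\<^sup>+ x. ennreal (f (t - x)) \<partial>N1) < \<infinity>"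
proof -
  interpret \<mu>: prob_space \<mu> by fact
  interpret \<mu>1: prob_space \<mu>1 by fact
  have s\<mu>: "sets \<mu> = sets borel" by (simp add: \<mu>)
  note [measurable_cong] = s\<mu> \<mu>1(2)
  have sN[measurable_cong]: "sets N1 = sets borel" "sets N = sets borel" by (simp_all add: N1_def N_def s\<mu> \<mu>1)
  interpret N: finite_measure N unfolding N_def by (rule \<mu>.finite_measure_restricted) (simp add: s\<mu>)
  interpret N1: finite_measure N1 unfolding N1_def by (rule \<mu>1.finite_measure_restricted) (simp add: \<mu>1)
  have neg: "AE x in N. x < 0" "AE x in N1. x < 0"
    unfolding N_def N1_def by (auto simp: AE_density split: split_indicator)
  define P where "P = density \<mu> (indicator {0..})"
  \<comment> \<open>Since the nonnegative parts coincide, \<open>f\<close> also serves as the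
    density in the mixed term of \<open>\<mu>1\<close>.\<close>
  have P1: "density \<mu>1 (indicator {0..}) = P"
    unfolding P_def by (rule density_indicator_eqI) (auto simp: s\<mu> \<mu>1 eq)
  define F where "F t = (\<integral>\<^sup>+ x. ennreal (f (t - x)) \<partial>N)" for t
  define F1 where "F1 t = (\<integral>\<^sup>+ x. ennreal (f (t - x)) \<partial>N1)" for t
  have [measurable]: "F \<in> borel_measurable borel" "F1 \<in> borel_measurable borel"
    unfolding F_def F1_def by measurable
  have cross: "(\<integral>\<^sup>+t. F1 t * indicator A t \<partial>lborel) = (\<integral>\<^sup>+t. F t * indicator A t \<partial>lborel) \<and>
      (\<integral>\<^sup>+t. F1 t * indicator A t \<partial>lborel) < \<infinity>"
    if A: "A \<in> sets borel" "A \<subseteq> {0..}" for A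
  proof -
    define PP where "PP = (\<integral>\<^sup>+x. \<integral>\<^sup>+y. indicator A (x + y) \<partial>P \<partial>P)"
    have 1: "emeasure (\<mu>1 \<star> \<mu>1) A = PP + 2 * (\<integral>\<^sup>+t. F1 t * indicator A t \<partial>lborel)"
      unfolding convolution_self_split[OF \<mu>1.finite_measure_axioms \<mu>1(2) A, unfolded P1, folded N1_def]
        nn_integral_cross_term[OF f N1.finite_measure_axioms sN(1) neg(2) A, folded \<mu>(1), folded P_def]
        PP_def F1_def ..
    have 2: "emeasure (\<mu> \<star> \<mu>) A = PP + 2 * (\<integral>\<^sup>+t. F t * indicator A t \<partial>lborel)"
      unfolding convolution_self_split[OF \<mu>.finite_measure_axioms s\<mu> A, folded P_def N_def]
        nn_integral_cross_term[OF f N.finite_measure_axioms sN(2) neg(1) A, folded \<mu>(1), folded P_def]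
        PP_def F_def ..
    have "emeasure (\<mu>1 \<star> \<mu>1) A < \<infinity>"
      using finite_measure.emeasure_finite[OF convolution_finite[OF \<mu>1.finite_measure_axioms
        \<mu>1.finite_measure_axioms \<mu>1(2) \<mu>1(2)]] by (simp add: less_top)
    with 1 have fin: "PP < \<infinity>" "(\<integral>\<^sup>+t. F1 t * indicator A t \<partial>lborel) < \<infinity>"
      by (auto simp: ennreal_mult_less_top)
    \<comment> \<open>Cancellation in \<open>ennreal\<close> requires \<open>PP\<close> to be
      finite.\<close>
    have "2 * (\<integral>\<^sup>+t. F1 t * indicator A t \<partial>lborel) = 2 * (\<integral>\<^sup>+t. F t * indicator A t \<partial>lborel)"
      using 1 2 eq2[OF A] fin(1) by (metis ennreal_add_left_cancel infinity_ennreal_def less_irrefl)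
    then show ?thesis using fin(2) by (simp add: ennreal_mult_cancel_left)
  qed
  have "density lborel (\<lambda>t. F1 t * indicator {0..} t) = density lborel (\<lambda>t. F t * indicator {0..} t)"
  proof (rule measure_eqI)
    fix A assume "A \<in> sets (density lborel (\<lambda>t. F1 t * indicator {0..} t))"
    then have [measurable]: "A \<in> sets borel" by simp
    have "{0..} \<inter> A \<in> sets borel" by simp
    from cross[OF this] show "emeasure (density lborel (\<lambda>t. F1 t * indicator {0..} t)) A =
        emeasure (density lborel (\<lambda>t. F t * indicator {0..} t)) A"
      by (simp add: emeasure_density indicator_inter_arith mult.assoc)
  qed simp
  then have "AE t in lborel. F1 t * indicator {0..} t = F t * indicator {0..} t"
    by (subst (asm) sigma_finite_measure.density_unique_iff[OF lborel.sigma_finite_measure_axioms]) auto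
  moreover have "AE t in lborel. F1 t * indicator {0..} t \<noteq> \<infinity>"
    using cross[of "{0..}"] by (intro nn_integral_PInf_AE) auto
  ultimately have "AE t in lborel. 0 \<le> t \<longrightarrow> F1 t = F t \<and> F1 t < \<infinity>"
    by eventually_elim (auto simp: less_top)
  then show ?thesis unfolding F_def F1_def .
qed

section \<open>The three uniqueness claims\<close>

text \<open>The recursion of \<open>conv_pow\<close> starts at the point mass in 0; this identifies
  its first two positive powers with \<open>M\<close> and \<open>M \<star> M\<close>.\<close>

lemma convolution_return_zero:
  fixes M :: "real measure"
  assumes "finite_measure M" "sets M = sets borel"
  shows "M \<star> return borel 0 = M"
proof (rule measure_eqI)
  fix A assume "A \<in> sets (M \<star> return borel 0)"
  then have [measurable]: "A \<in> sets borel" by simp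
  have "emeasure (M \<star> return borel 0) A = (\<integral>\<^sup>+x. \<integral>\<^sup>+y. indicator A (x + y) \<partial>return borel 0 \<partial>M)"
    by (rule convolution_emeasure')
      (auto simp: assms prob_space_return intro: prob_space.finite_measure)
  also have "\<dots> = (\<integral>\<^sup>+x. indicator A x \<partial>M)"
    by (intro nn_integral_cong) (subst nn_integral_return, auto)
  finally show "emeasure (M \<star> return borel 0) A = emeasure M A" by (simp add: assms(2))
qed (simp add: assms)

theorem theorem3p5:
  fixes \<mu> \<nu> :: "real measure" and f :: "real \<Rightarrow> real" and a :: real and as :: "nat \<Rightarrow> real"
  assumes mu_prob: "real_prob \<mu>"
    and f_meas: "f \<in> borel_measurable borel"
    and f_nonneg: "\<And>x. f x \<ge> 0"
    and mu_density: "\<mu> = density lborel (\<lambda>x. ennreal (f x))"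
    and supp: "\<not> measure_support \<mu> \<subseteq> {..<0}"
    and a_nonneg: "a \<ge> 0"
    and nu_sets: "sets \<nu> = sets borel"
    and nu_pos: "emeasure \<nu> {..0} = 0"
    and f_cm: "\<And>t. t > a \<Longrightarrow> ennreal (f t) = (\<integral>\<^sup>+ u. ennreal (exp (- u * t)) \<partial>\<nu>)"
    and as_mono: "strict_mono as"
    and as_supp: "\<And>n. as n \<in> measure_support \<nu>"
    and as_div: "\<not> summable (\<lambda>n. 1 / as n)"
  shows
    "(\<forall>g1 g2 :: real \<Rightarrow> real.
        g1 \<in> borel_measurable (restrict_space borel {0..}) \<longrightarrow>
        g2 \<in> borel_measurable (restrict_space borel {0..}) \<longrightarrow>
        (\<forall>s\<ge>0. g1 s \<ge> 0 \<and> g2 s \<ge> 0) \<longrightarrow>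
        (\<forall>t\<ge>0. (\<integral>\<^sup>+ s\<in>{0..}. ennreal (f (t + s) * g1 s) \<partial>lborel) < \<infinity>) \<longrightarrow>
        (\<forall>t\<ge>0. (\<integral>\<^sup>+ s\<in>{0..}. ennreal (f (t + s) * g2 s) \<partial>lborel) < \<infinity>) \<longrightarrow>
        (\<forall>t\<ge>0. (\<integral>\<^sup>+ s\<in>{0..}. ennreal (f (t + s) * g1 s) \<partial>lborel)
               = (\<integral>\<^sup>+ s\<in>{0..}. ennreal (f (t + s) * g2 s) \<partial>lborel)) \<longrightarrow>
        (AE s in lborel. s \<ge> 0 \<longrightarrow> g1 s = g2 s))
     \<and> (\<forall>\<mu>1. real_prob \<mu>1 \<longrightarrow>
        (\<forall>A\<in>sets borel. A \<subseteq> {0..} \<longrightarrow>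
           emeasure \<mu>1 A = emeasure \<mu> A \<and> emeasure (\<mu>1 \<star> \<mu>1) A = emeasure (\<mu> \<star> \<mu>) A) \<longrightarrow>
        \<mu>1 = \<mu>)
     \<and> \<mu> \<in> class_C"
proof (intro conjI)
  note [measurable] = f_meas
  have "\<forall>t>a. ennreal (f t) = (\<integral>\<^sup>+ u. ennreal (exp (- u * t)) \<partial>\<nu>)" using f_cm by blast
  note kernel_eqI = measure_eqI_cm_kernel[OF a_nonneg nu_sets nu_pos this as_mono as_supp as_div]
  show "\<forall>g1 g2 :: real \<Rightarrow> real.
        g1 \<in> borel_measurable (restrict_space borel {0..}) \<longrightarrow>
        g2 \<in> borel_measurable (restrict_space borel {0..}) \<longrightarrow>
        (\<forall>s\<ge>0. g1 s \<ge> 0 \<and> g2 s \<ge> 0) \<longrightarrow>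
        (\<forall>t\<ge>0. (\<integral>\<^sup>+ s\<in>{0..}. ennreal (f (t + s) * g1 s) \<partial>lborel) < \<infinity>) \<longrightarrow>
        (\<forall>t\<ge>0. (\<integral>\<^sup>+ s\<in>{0..}. ennreal (f (t + s) * g2 s) \<partial>lborel) < \<infinity>) \<longrightarrow>
        (\<forall>t\<ge>0. (\<integral>\<^sup>+ s\<in>{0..}. ennreal (f (t + s) * g1 s) \<partial>lborel)
               = (\<integral>\<^sup>+ s\<in>{0..}. ennreal (f (t + s) * g2 s) \<partial>lborel)) \<longrightarrow>
        (AE s in lborel. s \<ge> 0 \<longrightarrow> g1 s = g2 s)"
  proof (intro allI impI)
    fix g1 g2 :: "real \<Rightarrow> real"
    assume g: "g1 \<in> borel_measurable (restrict_space borel {0..})"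
        "g2 \<in> borel_measurable (restrict_space borel {0..})"
      and pos: "\<forall>s\<ge>0. g1 s \<ge> 0 \<and> g2 s \<ge> 0"
      and fin: "\<forall>t\<ge>0. (\<integral>\<^sup>+ s\<in>{0..}. ennreal (f (t + s) * g1 s) \<partial>lborel) < \<infinity>"
      and eq: "\<forall>t\<ge>0. (\<integral>\<^sup>+ s\<in>{0..}. ennreal (f (t + s) * g1 s) \<partial>lborel)
               = (\<integral>\<^sup>+ s\<in>{0..}. ennreal (f (t + s) * g2 s) \<partial>lborel)"
    \<comment> \<open>Extension by 0, since \<open>g\<close> is controlled only on
      \<open>{0..}\<close>. The density need not be integrable: its values are finite, which makes
      \<open>density lborel (E g)\<close> sigma-finite.\<close>
    define E where "E g s = ennreal (g s) * indicator {0..} s" for g :: "real \<Rightarrow> real" and s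
    have E[measurable]: "E g \<in> borel_measurable borel"
      if "g \<in> borel_measurable (restrict_space borel {0..})" for g
      unfolding E_def using measurable_compose[OF that measurable_ennreal]
      by (subst (asm) borel_measurable_restrict_space_iff_ennreal) auto
    have D: "sigma_finite_measure (density lborel (E g))" "sets (density lborel (E g)) = sets borel"
        "AE s in density lborel (E g). 0 \<le> s"
      if "g \<in> borel_measurable (restrict_space borel {0..})" for g
    proof -
      note [measurable] = E[OF that]
      show "sigma_finite_measure (density lborel (E g))"
        by (subst sigma_finite_measure.sigma_finite_iff_density_finite[OF lborel.sigma_finite_measure_axioms]) (auto simp: E_def ennreal_mult_eq_top_iff split: split_indicator)
      show "AE s in density lborel (E g). 0 \<le> s"
        by (subst AE_density) (auto simp: E_def split: split_indicator)
    qed simp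
    have int: "(\<integral>\<^sup>+ s. ennreal (f (t + s)) \<partial>density lborel (E g)) = (\<integral>\<^sup>+ s\<in>{0..}. ennreal (f (t + s) * g s) \<partial>lborel)"
      if "g \<in> borel_measurable (restrict_space borel {0..})" "\<forall>s\<ge>0. g s \<ge> 0" for g t
      using E[OF that(1)] that(2) f_nonneg
      by (subst nn_integral_density)
         (auto simp: E_def ennreal_mult mult_ac intro!: nn_integral_cong split: split_indicator)
    have "density lborel (E g1) = density lborel (E g2)"
    proof (rule kernel_eqI[OF D[OF g(1)] D[OF g(2)]], intro AE_I2 impI)
      fix t assume "a < t"
      with a_nonneg have "0 \<le> t" by simp
      with fin eq pos show "(\<integral>\<^sup>+ s. ennreal (f (t + s)) \<partial>density lborel (E g1)) =
          (\<integral>\<^sup>+ s. ennreal (f (t + s)) \<partial>density lborel (E g2)) \<and>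
          (\<integral>\<^sup>+ s. ennreal (f (t + s)) \<partial>density lborel (E g1)) < \<infinity>"
        by (simp add: int g)
    qed
    then have "AE s in lborel. E g1 s = E g2 s"
      using sigma_finite_measure.density_unique_iff[OF lborel.sigma_finite_measure_axioms, of "E g1" "E g2"]
        E[OF g(1)] E[OF g(2)] by simp
    then show "AE s in lborel. s \<ge> 0 \<longrightarrow> g1 s = g2 s"
    proof eventually_elim
      case (elim s)
      show ?case
      proof
        assume "0 \<le> s"
        with elim pos[rule_format, of s] show "g1 s = g2 s" by (simp add: E_def)
      qed
    qed
  qed
  show part2: "\<forall>\<mu>1. real_prob \<mu>1 \<longrightarrow>
        (\<forall>A\<in>sets borel. A \<subseteq> {0..} \<longrightarrow>
           emeasure \<mu>1 A = emeasure \<mu> A \<and> emeasure (\<mu>1 \<star> \<mu>1) A = emeasure (\<mu> \<star> \<mu>) A) \<longrightarrow>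
        \<mu>1 = \<mu>"
  proof (intro allI impI)
    fix \<mu>1 assume \<mu>1: "real_prob \<mu>1"
      and eq: "\<forall>A\<in>sets borel. A \<subseteq> {0..} \<longrightarrow>
           emeasure \<mu>1 A = emeasure \<mu> A \<and> emeasure (\<mu>1 \<star> \<mu>1) A = emeasure (\<mu> \<star> \<mu>) A"
    define N where "N M = density M (indicator {..<0})" for M :: "real measure"
    \<comment> \<open>Kernel uniqueness concerns measures on the nonnegative half-line, so the
      negative part is reflected: \<open>f (t - x)\<close> becomes \<open>f (t + s)\<close> with
      \<open>s = - x\<close>. Reflecting again recovers the negative part.\<close>
    define R where "R M = distr M borel uminus" for M :: "real measure"
    have AE_eq: "AE t in lborel. 0 \<le> t \<longrightarrow>
        (\<integral>\<^sup>+ x. ennreal (f (t - x)) \<partial>N \<mu>1) = (\<integral>\<^sup>+ x. ennreal (f (t - x)) \<partial>N \<mu>) \<and>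
        (\<integral>\<^sup>+ x. ennreal (f (t - x)) \<partial>N \<mu>1) < \<infinity>"
      unfolding N_def
      by (rule convolution_square_AE_kernel[OF f_meas mu_density])
         (use mu_prob \<mu>1 eq in \<open>simp_all add: real_prob_def\<close>)
    have RN: "sigma_finite_measure (R (N M))" "sets (R (N M)) = sets borel" "AE s in R (N M). 0 \<le> s"
        "\<And>t. (\<integral>\<^sup>+ s. ennreal (f (t + s)) \<partial>R (N M)) = (\<integral>\<^sup>+ x. ennreal (f (t - x)) \<partial>N M)"
        "R (R (N M)) = N M"
      if "real_prob M" for M
    proof -
      have M[measurable_cong]: "sets M = sets borel" using that by (simp add: real_prob_def)
      have s[measurable_cong]: "sets (N M) = sets borel" by (simp add: N_def M)
      interpret prob_space M using that by (simp add: real_prob_def)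
      interpret N: finite_measure "N M" unfolding N_def by (rule finite_measure_restricted) (simp add: M)
      interpret RN: finite_measure "R (N M)" unfolding R_def by (rule N.finite_measure_distr) measurable
      show "sigma_finite_measure (R (N M))" ..
      show "sets (R (N M)) = sets borel" by (simp add: R_def)
      have "AE x in N M. x < 0" unfolding N_def by (auto simp: AE_density split: split_indicator)
      then show "AE s in R (N M). 0 \<le> s" unfolding R_def by (subst AE_distr_iff) (auto elim: eventually_mono)
      show "(\<integral>\<^sup>+ s. ennreal (f (t + s)) \<partial>R (N M)) = (\<integral>\<^sup>+ x. ennreal (f (t - x)) \<partial>N M)" for t
        unfolding R_def by (subst nn_integral_distr) auto
      show "R (R (N M)) = N M"
        unfolding R_def by (subst distr_distr) (auto simp: o_def distr_id2[OF s[symmetric]])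
    qed
    have "R (N \<mu>1) = R (N \<mu>)"
    proof (rule kernel_eqI)
      show "AE t in lborel. a < t \<longrightarrow>
        (\<integral>\<^sup>+ s. ennreal (f (t + s)) \<partial>R (N \<mu>1)) = (\<integral>\<^sup>+ s. ennreal (f (t + s)) \<partial>R (N \<mu>)) \<and>
        (\<integral>\<^sup>+ s. ennreal (f (t + s)) \<partial>R (N \<mu>1)) < \<infinity>"
        unfolding RN(4)[OF \<mu>1] RN(4)[OF mu_prob] using AE_eq
        by eventually_elim (use a_nonneg in auto)
    qed (use RN \<mu>1 mu_prob in auto)
    then have Neq: "N \<mu>1 = N \<mu>" using RN(5) \<mu>1 mu_prob by metis
    have sets: "sets \<mu>1 = sets borel" "sets \<mu> = sets borel"
      using \<mu>1 mu_prob by (auto simp: real_prob_def)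
    show "\<mu>1 = \<mu>"
    proof (rule measure_eqI)
      fix A assume "A \<in> sets \<mu>1"
      then have A: "A \<in> sets borel" by (simp add: sets)
      have split: "emeasure M A = emeasure M ({0..} \<inter> A) + emeasure (N M) A" if "sets M = sets borel" for M
      proof -
        have "emeasure M A = emeasure M (({0..} \<inter> A) \<union> ({..<0} \<inter> A))"
          by (intro arg_cong[where f = "emeasure M"]) auto
        also have "\<dots> = emeasure M ({0..} \<inter> A) + emeasure M ({..<0} \<inter> A)"
          using A that by (intro plus_emeasure[symmetric]) auto
        also have "emeasure M ({..<0} \<inter> A) = emeasure (N M) A"
          unfolding N_def using A that by (subst emeasure_restricted) auto
        finally show ?thesis .
      qed
      have "emeasure \<mu>1 ({0..} \<inter> A) = emeasure \<mu> ({0..} \<inter> A)" using eq A by auto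
      then show "emeasure \<mu>1 A = emeasure \<mu> A"
        using split[OF sets(1)] split[OF sets(2)] Neq by simp
    qed (simp add: sets)
  qed
  show "\<mu> \<in> class_C"
    unfolding class_C_def mem_Collect_eq
  proof (intro conjI allI impI mu_prob)
    fix \<mu>1 assume \<mu>1: "real_prob \<mu>1"
      and eq: "\<forall>n\<ge>1. \<forall>A\<in>sets borel. A \<subseteq> {0..} \<longrightarrow>
            emeasure (conv_pow \<mu>1 n) A = emeasure (conv_pow \<mu> n) A"
    \<comment> \<open>The instances \<open>n = 1\<close> and \<open>n = 2\<close> are the
      assumptions of the preceding claim.\<close>
    have pow: "conv_pow M 1 = M" "conv_pow M 2 = (M \<star> M)" if "real_prob M" for M
      using that convolution_return_zero[of M]
      by (auto simp: real_prob_def numeral_2_eq_2 prob_space.finite_measure)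
    have "emeasure \<mu>1 A = emeasure \<mu> A \<and> emeasure (\<mu>1 \<star> \<mu>1) A = emeasure (\<mu> \<star> \<mu>) A"
      if "A \<in> sets borel" "A \<subseteq> {0..}" for A
      using eq[rule_format, of 1 A] eq[rule_format, of 2 A] that pow[OF \<mu>1] pow[OF mu_prob] by simp
    then show "\<mu>1 = \<mu>" using part2 \<mu>1 by blast
  qed
qed

end
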